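(* Let $Z=z_1e_1+z_2e_2$, $\mathcal{V}=\alpha+j\beta=\nu_1e_1+\nu_2e_2$ ($\alpha,\beta\in\mathbb{C}(i)$), $C=c_1e_1+c_2e_2\in\mathbb{BC}$, where $\alpha=\frac{l_1+l_2}{2}$ and $\beta=\frac{l_2-l_1}{2i}$ with $l_1,l_2\in\mathbb{Z}$. Then the bicomplex Miller-Ross function $E_{\mathcal{V},C}(Z)$ is an entire function of $Z$.
   Context: Bicomplex numbers: $\mathbb{BC}=\{w_1+jw_2: w_1,w_2\in\mathbb{C}(i)\}$, where $\mathbb{C}(i)$ is the complex field with unit $i$, $i^2=j^2=-1$, $ij=ji$. Put $e_1=\frac{1+ij}{2}$, $e_2=\frac{1-ij}{2}$, so $e_1+e_2=1$, $e_l^2=e_l$, $e_1e_2=0$. Every $Z=w_1+jw_2$ is uniquely $Z=z_1e_1+z_2e_2$ with $z_1=w_1-iw_2$, $z_2=w_1+iw_2\in\mathbb{C}(i)$, and addition, multiplication and division are componentwise in $e_1,e_2$; in particular $\nu_1=\alpha-i\beta$, $\nu_2=\alpha+i\beta$. The set of zero divisors is $\mathbb{O}_2=\{w_1+jw_2: w_1^2+w_2^2=0\}$, i.e. $z_1z_2=0$. Functions act componentwise: $\Gamma(Y)=\Gamma(y_1)e_1+\Gamma(y_2)e_2$ for $Y=y_1e_1+y_2e_2$ (with $1/\Gamma$ equal to $0$ at the poles of $\Gamma$), and $Z^{W}=z_1^{w_1}e_1+z_2^{w_2}e_2$ for $Z=z_1e_1+z_2e_2$, $W=w_1e_1+w_2e_2$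 (usual powers, $0^0=1$, for integer exponents). Bicomplex Miller-Ross function: $E_{\mathcal{V},C}(Z)=Z^{\mathcal{V}}\sum_{r=0}^{\infty}\frac{(CZ)^r}{\Gamma(\mathcal{V}+r+1)}$ for $\mathcal{V},C,Z\in\mathbb{BC}$. When an idempotent component $\nu_l$ is a negative integer, the prefactor $z_l^{\nu_l}$ is multiplied into the series term by term (terms with $1/\Gamma=0$ vanish), which defines the component also at $z_l=0$. A function $f:\Omega\subset\mathbb{BC}\to\mathbb{BC}$ is bicomplex holomorphic in $\Omega$ if at each $Z_0\in\Omega$ the limit of $\frac{f(Z_0+\Delta Z)-f(Z_0)}{\Delta Z}$ as $\Delta Z\to0$, $\Delta Z\notin\mathbb{O}_2$, exists finitely; entire means bicomplex holomorphic on all of $\mathbb{BC}$. *)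

theory Defs
  imports "HOL-Analysis.Analysis"
begin

text \<open>The bicomplex number \<open>w\<^sub>1 + j w\<^sub>2\<close>; the type \<^typ>\<open>complex\<close> plays the role of \<open>\<complex>(i)\<close>.\<close>

datatype bicomplex = Bicomplex (bc1: complex) (bc2: complex)

lemma bicomplex_eq_iff: "Z = W \<longleftrightarrow> bc1 Z = bc1 W \<and> bc2 Z = bc2 W"
  by (cases Z; cases W) simp

instantiation bicomplex :: comm_ring_1
begin

definition "0 = Bicomplex 0 0"
definition "1 = Bicomplex 1 0"
definition "Z + W = Bicomplex (bc1 Z + bc1 W) (bc2 Z + bc2 W)"
definition "Z - W = Bicomplex (bc1 Z - bc1 W) (bc2 Z - bc2 W)"
definition "- Z = Bicomplex (- bc1 Z) (- bc2 Z)"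
definition "Z * W = Bicomplex (bc1 Z * bc1 W - bc2 Z * bc2 W) (bc1 Z * bc2 W + bc2 Z * bc1 W)"

instance
  by standard
    (simp_all add: bicomplex_eq_iff zero_bicomplex_def one_bicomplex_def plus_bicomplex_def
      minus_bicomplex_def uminus_bicomplex_def times_bicomplex_def algebra_simps)

end

lemma bc_sel_simps [simp]:
  "bc1 0 = 0" "bc2 0 = 0" "bc1 1 = 1" "bc2 1 = 0"
  "bc1 (Z + W) = bc1 Z + bc1 W" "bc2 (Z + W) = bc2 Z + bc2 W"
  "bc1 (Z - W) = bc1 Z - bc1 W" "bc2 (Z - W) = bc2 Z - bc2 W"
  "bc1 (- Z) = - bc1 Z" "bc2 (- Z) = - bc2 Z"
  "bc1 (Z * W) = bc1 Z * bc1 W - bc2 Z * bc2 W"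
  "bc2 (Z * W) = bc1 Z * bc2 W + bc2 Z * bc1 W"
  by (simp_all add: zero_bicomplex_def one_bicomplex_def plus_bicomplex_def
      minus_bicomplex_def uminus_bicomplex_def times_bicomplex_def)

text \<open>The topology is that of \<open>\<complex>\<^sup>2\<close>, given by the Euclidean norm.\<close>

instantiation bicomplex :: real_normed_vector
begin

definition "scaleR r Z = Bicomplex (scaleR r (bc1 Z)) (scaleR r (bc2 Z))"
definition "norm Z = sqrt ((norm (bc1 Z))\<^sup>2 + (norm (bc2 Z))\<^sup>2)"
definition "sgn (Z::bicomplex) = scaleR (inverse (norm Z)) Z"
definition "dist Z W = norm (Z - W :: bicomplex)"
definition [code del]:
  "(uniformity :: (bicomplex \<times> bicomplex) filter) = (INF e\<in>{0<..}. principal {(x, y). dist x y < e})"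
definition [code del]:
  "open (U :: bicomplex set) \<longleftrightarrow> (\<forall>x\<in>U. \<forall>\<^sub>F (x', y) in uniformity. x' = x \<longrightarrow> y \<in> U)"

instance
proof
  fix Z W :: bicomplex and a b :: real
  have norm_pair: "norm X = norm (bc1 X, bc2 X)" for X :: bicomplex
    by (simp add: norm_bicomplex_def norm_Pair)
  show "norm (Z + W) \<le> norm Z + norm W"
    using norm_triangle_ineq[of "(bc1 Z, bc2 Z)" "(bc1 W, bc2 W)"] by (simp add: norm_pair)
  show "norm (a *\<^sub>R Z) = \<bar>a\<bar> * norm Z"
    using norm_scaleR[of a "(bc1 Z, bc2 Z)"] by (simp add: norm_pair scaleR_bicomplex_def)
  show "norm Z = 0 \<longleftrightarrow> Z = 0"
    by (simp add: norm_pair prod_eq_iff bicomplex_eq_iff)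
qed (simp_all add: bicomplex_eq_iff scaleR_bicomplex_def sgn_bicomplex_def dist_bicomplex_def
    uniformity_bicomplex_def open_bicomplex_def algebra_simps)

end

definition bc_of_complex :: "complex \<Rightarrow> bicomplex" where
  "bc_of_complex w = Bicomplex w 0"

definition bc_j :: bicomplex where
  "bc_j = Bicomplex 0 1"

lemma bicomplex_cartesian: "Z = bc_of_complex (bc1 Z) + bc_j * bc_of_complex (bc2 Z)"
  by (simp add: bicomplex_eq_iff bc_of_complex_def bc_j_def)

definition bc_e1 :: bicomplex where
  "bc_e1 = bc_of_complex (1/2) * (1 + bc_of_complex \<i> * bc_j)"

definition bc_e2 :: bicomplex where
  "bc_e2 = bc_of_complex (1/2) * (1 - bc_of_complex \<i> * bc_j)"

text \<open>The idempotent components \<open>z\<^sub>1\<close>, \<open>z\<^sub>2\<close> of \<open>Z = z\<^sub>1 e\<^sub>1 + z\<^sub>2 e\<^sub>2\<close>, and the number with given components.\<close>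

definition idem1 :: "bicomplex \<Rightarrow> complex" where
  "idem1 Z = bc1 Z - \<i> * bc2 Z"

definition idem2 :: "bicomplex \<Rightarrow> complex" where
  "idem2 Z = bc1 Z + \<i> * bc2 Z"

definition of_idem :: "complex \<Rightarrow> complex \<Rightarrow> bicomplex" where
  "of_idem a b = bc_of_complex a * bc_e1 + bc_of_complex b * bc_e2"

lemmas idem_defs = of_idem_def idem1_def idem2_def bc_e1_def bc_e2_def bc_of_complex_def bc_j_def

lemma of_idem_idem [simp]: "of_idem (idem1 Z) (idem2 Z) = Z"
  by (simp add: bicomplex_eq_iff idem_defs field_simps)

lemma idem1_of_idem [simp]: "idem1 (of_idem a b) = a"
  by (simp add: idem_defs field_simps)

lemma idem2_of_idem [simp]: "idem2 (of_idem a b) = b"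
  by (simp add: idem_defs field_simps)

lemma idem_eq_iff: "Z = W \<longleftrightarrow> idem1 Z = idem1 W \<and> idem2 Z = idem2 W"
  by (metis of_idem_idem)

lemma idem_add [simp]: "idem1 (Z + W) = idem1 Z + idem1 W" "idem2 (Z + W) = idem2 Z + idem2 W"
  and idem_diff [simp]: "idem1 (Z - W) = idem1 Z - idem1 W" "idem2 (Z - W) = idem2 Z - idem2 W"
  and idem_0 [simp]: "idem1 0 = 0" "idem2 0 = 0"
  and idem_1 [simp]: "idem1 1 = 1" "idem2 1 = 1"
  by (simp_all add: idem1_def idem2_def algebra_simps)

lemma idem_mult [simp]: "idem1 (Z * W) = idem1 Z * idem1 W" "idem2 (Z * W) = idem2 Z * idem2 W"
  by (simp_all add: idem1_def idem2_def complex_eq_iff algebra_simps)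

lemma idem_power [simp]: "idem1 (Z ^ n) = idem1 Z ^ n" "idem2 (Z ^ n) = idem2 Z ^ n"
  by (induction n) simp_all

lemma idem_of_nat [simp]: "idem1 (of_nat n) = of_nat n" "idem2 (of_nat n) = of_nat n"
  by (induction n) simp_all

definition zero_divisors :: "bicomplex set" where
  "zero_divisors = {Z. (bc1 Z)\<^sup>2 + (bc2 Z)\<^sup>2 = 0}"

lemma mem_zero_divisors_iff: "Z \<in> zero_divisors \<longleftrightarrow> idem1 Z * idem2 Z = 0"
proof -
  have "idem1 Z * idem2 Z = (bc1 Z)\<^sup>2 - \<i>\<^sup>2 * (bc2 Z)\<^sup>2"
    unfolding idem1_def idem2_def by algebra
  then show ?thesis by (simp add: zero_divisors_def)
qed

text \<open>Division is componentwise. It is the division of the ring outside the zero divisors, the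
  only place where it is used; on them, \<open>inverse 0 = 0\<close> in \<^typ>\<open>complex\<close> applies to each component.\<close>

instantiation bicomplex :: inverse
begin

definition "inverse Z = of_idem (inverse (idem1 Z)) (inverse (idem2 Z))" for Z :: bicomplex

definition "Z div W = Z * inverse W" for Z W :: bicomplex

instance ..

end

lemma bicomplex_mult_inverse: "Z \<notin> zero_divisors \<Longrightarrow> Z * inverse Z = 1"
  by (simp add: idem_eq_iff inverse_bicomplex_def mem_zero_divisors_iff)

text \<open>For a set \<open>\<Omega>\<close> that is not open, the increments are understood to stay in \<open>\<Omega>\<close>.\<close>

definition bc_holomorphic_on :: "(bicomplex \<Rightarrow> bicomplex) \<Rightarrow> bicomplex set \<Rightarrow> bool" where
  "bc_holomorphic_on f \<Omega> \<longleftrightarrow>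
     (\<forall>Z0\<in>\<Omega>. \<exists>L. ((\<lambda>H. (f (Z0 + H) - f Z0) / H) \<longlongrightarrow> L)
        (at 0 within {H. H \<notin> zero_divisors \<and> Z0 + H \<in> \<Omega>}))"

definition bc_entire :: "(bicomplex \<Rightarrow> bicomplex) \<Rightarrow> bool" where
  "bc_entire f \<longleftrightarrow> bc_holomorphic_on f UNIV"

text \<open>The usual power: \<open>0\<^sup>0 = 1\<close> and \<open>0\<^sup>n = 0\<close> for integers \<open>n \<noteq> 0\<close>, principal branch for non-integer
  exponents. (\<open>powr\<close> alone would give \<open>0 powr n = 0\<close> also for \<open>n = 0\<close>.)\<close>

definition cpower :: "complex \<Rightarrow> complex \<Rightarrow> complex" where
  "cpower z w = (if w \<in> \<int> then z powi \<lfloor>Re w\<rfloor> else z powr w)"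

definition bc_power :: "bicomplex \<Rightarrow> bicomplex \<Rightarrow> bicomplex" where
  "bc_power Z W = of_idem (cpower (idem1 Z) (idem1 W)) (cpower (idem2 Z) (idem2 W))"

text \<open>The reciprocal of the componentwise Gamma function; \<^term>\<open>rGamma\<close> vanishes at the poles.\<close>

definition bc_rGamma :: "bicomplex \<Rightarrow> bicomplex" where
  "bc_rGamma Y = of_idem (rGamma (idem1 Y)) (rGamma (idem2 Y))"

definition neg_integer :: "complex \<Rightarrow> bool" where
  "neg_integer \<nu> \<longleftrightarrow> \<nu> \<in> \<int> \<and> Re \<nu> < 0"

text \<open>One idempotent component of the Miller-Ross function. If \<open>\<nu>\<close> is a negative integer, the
  prefactor \<open>z\<^sup>\<nu>\<close> is multiplied into the series; there \<open>z\<^sup>r z\<^sup>\<nu>\<close> has to be merged into \<open>z\<^sup>\<nu>\<^sup>+\<^sup>r\<close> to get the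
  right value at \<open>z = 0\<close>.\<close>

definition miller_ross_component :: "complex \<Rightarrow> complex \<Rightarrow> complex \<Rightarrow> complex" where
  "miller_ross_component \<nu> c z =
     (if neg_integer \<nu>
      then (\<Sum>r. c ^ r * cpower z (\<nu> + of_nat r) * rGamma (\<nu> + of_nat r + 1))
      else cpower z \<nu> * (\<Sum>r. (c * z) ^ r * rGamma (\<nu> + of_nat r + 1)))"

definition miller_ross :: "bicomplex \<Rightarrow> bicomplex \<Rightarrow> bicomplex \<Rightarrow> bicomplex" where
  "miller_ross V C Z =
     of_idem (miller_ross_component (idem1 V) (idem1 C) (idem1 Z))
             (miller_ross_component (idem2 V) (idem2 C) (idem2 Z))"

text \<open>Unless some \<open>z\<^sub>l = 0\<close> while \<open>\<nu>\<^sub>l\<close> is a negative integer, this is the defining bicomplex series.\<close>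

lemma summable_miller_ross: "summable (\<lambda>r. x ^ r * rGamma (\<nu> + of_nat r + 1 :: complex))"
proof (rule summable_ratio_test[of "1/2" "nat \<lceil>norm \<nu> + 2 * norm x\<rceil>"])
  fix n assume "n \<ge> nat \<lceil>norm \<nu> + 2 * norm x\<rceil>"
  then have n: "norm \<nu> + 2 * norm x \<le> real n" by linarith
  let ?y = "\<nu> + of_nat n + 1"
  have "real n + 1 = norm (?y - \<nu>)"
    using norm_of_nat[of "Suc n", where 'a = complex] by (simp add: add.commute)
  also have "\<dots> \<le> norm ?y + norm \<nu>" by (rule norm_triangle_ineq4)
  finally have y: "2 * norm x \<le> norm ?y" and y0: "0 < norm ?y"
    using n norm_ge_zero[of x] by linarith+
  have "2 * norm x * norm (rGamma (?y + 1)) \<le> norm ?y * norm (rGamma (?y + 1))"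
    using y by (intro mult_right_mono) auto
  also have "\<dots> = norm (rGamma ?y)"
    by (metis norm_mult rGamma_plus1)
  finally have "norm x * norm (rGamma (?y + 1)) \<le> 1 / 2 * norm (rGamma ?y)" by simp
  from mult_left_mono[OF this, of "norm x ^ n"]
  show "norm (x ^ Suc n * rGamma (\<nu> + of_nat (Suc n) + 1))
        \<le> 1 / 2 * norm (x ^ n * rGamma (\<nu> + of_nat n + 1))"
    by (simp add: norm_mult norm_power algebra_simps)
qed simp

lemma miller_ross_component_eq:
  assumes "\<not> neg_integer \<nu> \<or> z \<noteq> 0"
  shows "miller_ross_component \<nu> c z = cpower z \<nu> * (\<Sum>r. (c * z) ^ r * rGamma (\<nu> + of_nat r + 1))"
proof (cases "neg_integer \<nu>")
  case True
  then obtain k where k: "\<nu> = of_int k" and z: "z \<noteq> 0"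
    using assms by (auto simp: neg_integer_def elim: Ints_cases)
  have "cpower z (\<nu> + of_nat r) = cpower z \<nu> * z ^ r" for r
  proof -
    have "cpower z (\<nu> + of_nat r) = z powi (k + int r)"
      by (simp add: cpower_def k flip: of_nat_add)
    then show ?thesis using z by (simp add: cpower_def k power_int_add)
  qed
  then have "miller_ross_component \<nu> c z =
      (\<Sum>r. cpower z \<nu> * ((c * z) ^ r * rGamma (\<nu> + of_nat r + 1)))"
    using True by (simp add: miller_ross_component_def power_mult_distrib mult_ac)
  then show ?thesis by (simp add: suminf_mult summable_miller_ross)
qed (simp add: miller_ross_component_def)

lemma of_idem_add: "of_idem a b + of_idem c d = of_idem (a + c) (b + d)"
  by (simp add: idem_eq_iff)

lemma bc_sums_of_idem:
  assumes "f sums a" "g sums b"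
  shows "(\<lambda>r. of_idem (f r) (g r)) sums of_idem a b"
proof -
  have S: "(\<Sum>r<n. of_idem (f r) (g r)) = of_idem (\<Sum>r<n. f r) (\<Sum>r<n. g r)" for n
    by (induction n) (simp_all add: of_idem_add, simp add: idem_eq_iff)
  have N: "norm (of_idem x y - of_idem a b) \<le> norm (x - a) + norm (y - b)" for x y
  proof -
    have D: "of_idem x y - of_idem a b = of_idem (x - a) (y - b)"
      by (simp add: idem_eq_iff)
    have "norm (of_idem u v) \<le> norm u + norm v" for u v
    proof -
      have A: "bc1 (of_idem u v) = (u + v) / 2" "bc2 (of_idem u v) = \<i> * (u - v) / 2"
        by (simp_all add: idem_defs field_simps)
      have "norm (of_idem u v) \<le> norm (bc1 (of_idem u v)) + norm (bc2 (of_idem u v))"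
        unfolding norm_bicomplex_def by (rule sqrt_sum_squares_le_sum) auto
      also have "\<dots> \<le> norm u + norm v"
        unfolding A using norm_triangle_ineq[of u v] norm_triangle_ineq4[of u v]
        by (simp add: norm_mult norm_divide)
      finally show ?thesis .
    qed
    then show ?thesis unfolding D .
  qed
  have "(\<lambda>n. norm ((\<Sum>r<n. f r) - a) + norm ((\<Sum>r<n. g r) - b)) \<longlonglongrightarrow> 0"
    using assms by (auto simp: sums_def intro!: tendsto_add_zero tendsto_norm_zero LIM_zero)
  then have "(\<lambda>n. of_idem (\<Sum>r<n. f r) (\<Sum>r<n. g r) - of_idem a b) \<longlonglongrightarrow> 0"
    by (rule Lim_null_comparison[OF always_eventually[OF allI[OF N]]])
  then show ?thesis unfolding sums_def S by (rule LIM_zero_cancel)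
qed

lemma miller_ross_eq:
  assumes "\<not> neg_integer (idem1 V) \<or> idem1 Z \<noteq> 0" "\<not> neg_integer (idem2 V) \<or> idem2 Z \<noteq> 0"
  shows "miller_ross V C Z =
    bc_power Z V * (\<Sum>r. (C * Z) ^ r * bc_rGamma (V + of_nat r + 1))"
proof -
  let ?s = "\<lambda>\<nu> x r. x ^ r * rGamma (\<nu> + of_nat r + 1 :: complex)"
  have "(C * Z) ^ r * bc_rGamma (V + of_nat r + 1) =
      of_idem (?s (idem1 V) (idem1 C * idem1 Z) r) (?s (idem2 V) (idem2 C * idem2 Z) r)" for r
    by (simp add: idem_eq_iff bc_rGamma_def)
  then have "(\<Sum>r. (C * Z) ^ r * bc_rGamma (V + of_nat r + 1)) =
      of_idem (suminf (?s (idem1 V) (idem1 C * idem1 Z))) (suminf (?s (idem2 V) (idem2 C * idem2 Z)))"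
    by (simp add: sums_unique[symmetric] bc_sums_of_idem summable_sums[OF summable_miller_ross])
  then show ?thesis
    using assms by (simp add: miller_ross_def miller_ross_component_eq idem_eq_iff bc_power_def)
qed

end

theory Submission
  imports Defs
begin

text \<open>An integer order makes each idempotent component entire on the complex plane: for
  \<open>\<nu> = - m < 0\<close> the first \<open>m\<close> terms of the series, which carry the negative powers of \<open>z\<close>, are
  killed by the poles of \<open>\<Gamma>\<close>. A pair of entire functions acting on the idempotent components is
  bicomplex entire, since a difference quotient with an increment off the zero divisors is the pair
  of the component difference quotients.\<close>

text \<open>Parallelogram law for \<open>bc1 Z\<close> and \<open>\<i> * bc2 Z\<close>, whose
  difference and sum are the idempotent components.\<close>

lemma norm_bicomplex_idem: "(norm Z)\<^sup>2 = ((norm (idem1 Z))\<^sup>2 + (norm (idem2 Z))\<^sup>2) / 2"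
  unfolding norm_bicomplex_def idem1_def idem2_def
  by (simp add: cmod_power2) (simp add: power2_eq_square algebra_simps)

text \<open>The sharp constant is the square root of 2; the cruder 2 avoids the root and suffices
  for limits.\<close>

lemma norm_idem_le: "norm (idem1 Z) \<le> 2 * norm Z" "norm (idem2 Z) \<le> 2 * norm Z"
proof -
  have "(norm (idem1 Z))\<^sup>2 \<le> (2 * norm Z)\<^sup>2" "(norm (idem2 Z))\<^sup>2 \<le> (2 * norm Z)\<^sup>2"
    by (simp_all add: power_mult_distrib norm_bicomplex_idem)
  then show "norm (idem1 Z) \<le> 2 * norm Z" "norm (idem2 Z) \<le> 2 * norm Z"
    by (auto intro: power2_le_imp_le)
qed

lemma norm_of_idem_le: "norm (of_idem a b) \<le> norm a + norm b"
proof (rule power2_le_imp_le)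
  have "(norm a)\<^sup>2 + (norm b)\<^sup>2 \<le> 2 * (norm a + norm b)\<^sup>2"
    by (simp add: power2_sum)
  then show "(norm (of_idem a b))\<^sup>2 \<le> (norm a + norm b)\<^sup>2"
    by (simp add: norm_bicomplex_idem)
qed simp

lemma tendsto_idem_0: "(idem1 \<longlongrightarrow> 0) (at 0 within S)" "(idem2 \<longlongrightarrow> 0) (at 0 within S)"
proof -
  have lim: "((\<lambda>H::bicomplex. 2 * norm H) \<longlongrightarrow> 0) (at 0 within S)"
    by (auto intro!: tendsto_eq_intros)
  show "(idem1 \<longlongrightarrow> 0) (at 0 within S)" "(idem2 \<longlongrightarrow> 0) (at 0 within S)"
    by (rule Lim_null_comparison[OF always_eventually lim], simp add: norm_idem_le)+
qed

lemma tendsto_of_idem: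
  assumes "(f \<longlongrightarrow> a) F" "(g \<longlongrightarrow> b) F"
  shows "((\<lambda>x. of_idem (f x) (g x)) \<longlongrightarrow> of_idem a b) F"
proof -
  have lim: "((\<lambda>x. norm (f x - a) + norm (g x - b)) \<longlongrightarrow> 0) F"
    using assms by (auto intro!: tendsto_add_zero tendsto_norm_zero LIM_zero)
  have "of_idem (f x) (g x) - of_idem a b = of_idem (f x - a) (g x - b)" for x
    by (simp add: idem_eq_iff)
  then have "((\<lambda>x. of_idem (f x) (g x) - of_idem a b) \<longlongrightarrow> 0) F"
    by (intro Lim_null_comparison[OF always_eventually lim]) (simp add: norm_of_idem_le)
  then show ?thesis by (rule LIM_zero_cancel)
qed

lemma bc_entire_of_idem:
  assumes f: "\<And>z. f field_differentiable at z" and g: "\<And>z. g field_differentiable at z"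
  shows "bc_entire (\<lambda>Z. of_idem (f (idem1 Z)) (g (idem2 Z)))"
  unfolding bc_entire_def bc_holomorphic_on_def
proof
  fix Z0 :: bicomplex
  let ?F = "at 0 within {H. H \<notin> zero_divisors \<and> Z0 + H \<in> UNIV}"
  let ?q = "\<lambda>f z h. (f (z + h) - f z) / (h :: complex)"
  obtain a b where "(f has_field_derivative a) (at (idem1 Z0))"
    and "(g has_field_derivative b) (at (idem2 Z0))"
    using f g unfolding field_differentiable_def by blast
  then have quot: "(?q f (idem1 Z0) \<longlongrightarrow> a) (at 0)" "(?q g (idem2 Z0) \<longlongrightarrow> b) (at 0)"
    by (simp_all add: DERIV_def)
  \<comment> \<open>Both component increments must avoid 0, so that the punctured limits in
    \<open>quot\<close> can be composed with \<open>idem1\<close> and \<open>idem2\<close>.\<close>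
  have ev: "\<forall>\<^sub>F H in ?F. idem1 H \<noteq> 0 \<and> idem2 H \<noteq> 0"
    by (auto simp: eventually_at_filter mem_zero_divisors_iff)
  have "filterlim idem1 (at 0) ?F" "filterlim idem2 (at 0) ?F"
    using ev by (auto simp: filterlim_at tendsto_idem_0 elim: eventually_mono)
  then have "((\<lambda>H. of_idem (?q f (idem1 Z0) (idem1 H)) (?q g (idem2 Z0) (idem2 H))) \<longlongrightarrow> of_idem a b) ?F"
    by (intro tendsto_of_idem filterlim_compose[OF quot(1)] filterlim_compose[OF quot(2)])
  \<comment> \<open>No condition on \<open>H\<close> is needed: division on both sides is
    multiplication by the componentwise inverse, with \<open>inverse 0 = 0\<close>.\<close>
  moreover have "(of_idem (f (idem1 (Z0 + H))) (g (idem2 (Z0 + H))) -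
      of_idem (f (idem1 Z0)) (g (idem2 Z0))) / H =
      of_idem (?q f (idem1 Z0) (idem1 H)) (?q g (idem2 Z0) (idem2 H))" for H
    by (simp add: idem_eq_iff divide_bicomplex_def inverse_bicomplex_def divide_inverse)
  ultimately show "\<exists>L. ((\<lambda>H. (of_idem (f (idem1 (Z0 + H))) (g (idem2 (Z0 + H))) -
      of_idem (f (idem1 Z0)) (g (idem2 Z0))) / H) \<longlongrightarrow> L) ?F"
    by auto
qed

text \<open>As a power series in z it converges everywhere, so it may be differentiated term by
  term.\<close>

lemma field_differentiable_miller_ross_series:
  "(\<lambda>z. \<Sum>r. (c * z) ^ r * rGamma (\<nu> + of_nat r + 1)) field_differentiable at (z::complex)"
proof -
  let ?a = "\<lambda>r. c ^ r * rGamma (\<nu> + of_nat r + 1)"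
  have eq: "(c * x) ^ r * rGamma (\<nu> + of_nat r + 1) = ?a r * x ^ r" for r x
    by (simp add: power_mult_distrib mult_ac)
  have "summable (\<lambda>r. ?a r * x ^ r)" for x
    using summable_miller_ross[of "c * x" \<nu>] by (simp only: eq)
  from termdiffs_strong_converges_everywhere[OF this] show ?thesis
    unfolding eq field_differentiable_def by blast
qed

lemma miller_ross_component_of_nat:
  "miller_ross_component (of_nat n) c z = z ^ n * (\<Sum>r. (c * z) ^ r * rGamma (of_nat n + of_nat r + 1))"
  by (simp add: miller_ross_component_def neg_integer_def cpower_def)

text \<open>Dropping the m vanishing terms leaves \<open>c ^ m\<close> times the exponential series
  of c z. The summand \<open>0 +\<close> presents it as the general series with \<nu> = 0, to which
  the lemmas on that series apply.\<close>

lemma miller_ross_component_neg_of_nat: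
  assumes "m > 0"
  shows "miller_ross_component (- of_nat m) c z = c ^ m * (\<Sum>r. (c * z) ^ r * rGamma (0 + of_nat r + 1))"
proof -
  let ?t = "\<lambda>r. c ^ r * cpower z (- of_nat m + of_nat r) * rGamma (- of_nat m + of_nat r + 1)"
  have zero: "?t r = 0" if "r < m" for r
  proof -
    \<comment> \<open>The natural subtraction is exact since r < m, so the argument is a pole of
      Gamma.\<close>
    have "- of_nat m + of_nat r + (1::complex) = - of_nat (m - Suc r)"
      using that by simp
    then show ?thesis by (simp only: rGamma_neg_of_nat mult_zero_right)
  qed
  \<comment> \<open>The exponent of z becomes the natural number r, so the identity also holds at z
    = 0, with \<open>0 ^ 0 = 1\<close>.\<close>
  have shift: "?t (r + m) = c ^ m * ((c * z) ^ r * rGamma (0 + of_nat r + 1))" for r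
    by (simp add: cpower_def power_add power_mult_distrib)
  have "summable (\<lambda>r. (c * z) ^ r * rGamma (0 + of_nat r + 1))"
    by (rule summable_miller_ross)
  then have "(\<lambda>r. ?t (r + m)) sums (c ^ m * (\<Sum>r. (c * z) ^ r * rGamma (0 + of_nat r + 1)))"
    unfolding shift by (intro sums_mult summable_sums)
  then have "?t sums (c ^ m * (\<Sum>r. (c * z) ^ r * rGamma (0 + of_nat r + 1)))"
    by (subst (asm) sums_zero_iff_shift) (use zero in auto)
  moreover have "neg_integer (- of_nat m)"
    using assms by (simp add: neg_integer_def)
  ultimately show ?thesis
    by (simp add: miller_ross_component_def sums_unique[symmetric])
qed

lemma field_differentiable_miller_ross_component:
  "miller_ross_component (of_int k) c field_differentiable at z"
proof (cases "k \<ge> 0")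
  case True
  then obtain n where "k = int n" by (metis nonneg_int_cases)
  then have "miller_ross_component (of_int k) c =
      (\<lambda>z. z ^ n * (\<Sum>r. (c * z) ^ r * rGamma (of_nat n + of_nat r + 1)))"
    by (intro ext) (simp only: of_int_of_nat_eq miller_ross_component_of_nat)
  then show ?thesis
    by (simp only:) (intro field_differentiable_mult field_differentiable_power
      field_differentiable_ident field_differentiable_miller_ross_series)
next
  case False
  then obtain m where "k = - int m" "m > 0" by (metis not_le neg_int_cases)
  then have "miller_ross_component (of_int k) c =
      (\<lambda>z. c ^ m * (\<Sum>r. (c * z) ^ r * rGamma (0 + of_nat r + 1)))"
    by (intro ext) (simp only: of_int_minus of_int_of_nat_eq miller_ross_component_neg_of_nat)
  then show ?thesis
    by (simp only:) (intro field_differentiable_mult field_differentiable_const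
      field_differentiable_miller_ross_series)
qed

theorem theorem5p3:
  fixes l1 l2 :: int and \<alpha> \<beta> :: complex and V C :: bicomplex
  assumes "V = bc_of_complex \<alpha> + bc_j * bc_of_complex \<beta>"
    and "\<alpha> = (of_int l1 + of_int l2) / 2"
    and "\<beta> = (of_int l2 - of_int l1) / (2 * \<i>)"
  shows "bc_entire (\<lambda>Z. miller_ross V C Z)"
proof -
  \<comment> \<open>These are \<alpha> - \<i> \<beta> and \<alpha> + \<i> \<beta>; the hypotheses on
    \<alpha> and \<beta> say exactly that both are integers.\<close>
  have "idem1 V = of_int l1" "idem2 V = of_int l2"
    by (simp_all add: assms idem_defs field_simps)
  then show ?thesis
    unfolding miller_ross_def
    by (simp add: bc_entire_of_idem field_differentiable_miller_ross_component)
qed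

end
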